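(* The following statements hold. (1) For each $i\in\{0,1,2,3,4\}$, the graph $H_i$ is $(P_2\cup 3P_1)$-free, contains no $2$-factor, and $\tau(H_i)=1$. The graph $H_1$ is also $(P_3\cup 2P_1)$-free. (2) For each $i\in\{5,6,\dots,11\}$, the graph $H_i$ (where $H_5$ is taken with $p=5$) is $(P_2\cup 5P_1)$-free and contains no $2$-factor. The graph $H_5$ with $p=5$ is $(P_3\cup 4P_1)$-free and $6P_1$-free. Furthermore, $\tau(H_5)=\frac65$ when $p=5$, and $\tau(H_i)=\frac76$ for each $i\in\{6,\dots,11\}$.
   Context: All graphs are finite, simple and undirected. $P_b$ is the path on $b$ vertices; $aP_b$ is the disjoint union of $a$ copies of $P_b$; unions are vertex-disjoint. $G$ is $R$-free if $G$ has no induced subgraph isomorphic to $R$. A $2$-factor is a $2$-regular spanning subgraph. $c(G)$ is the number of components of $G$; $G$ is $t$-tough if $t\cdot c(G-W)\le |W|$ for every cutset $W$ (every $W\subseteq V(G)$ with $c(G-W)\ge2$). For non-complete $G$, the toughness $\tau(G)$ is the maximum $t$ such that $G$ is $t$-tough. Graphs: - $H_0$ has vertices $t_1,t_2,t_3,v_1,\dots,v_6$; edges: the triangles $v_1v_2v_3$ and $v_4v_5v_6$, and $t_1v_1,t_1v_4,t_2v_2,t_2v_5,t_3v_3,t_3v_6$. - $H_1,\dots,H_4$ have vertices $x,t_1,t_2,t_3$ and edges $xt_1,xt_2,xt_3$, together with the following. - $H_1$: further vertices $v_1,v_2,v_3$; the triangle $v_1v_2v_3$ and $t_1v_1,t_2v_2,t_3v_3$.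 - $H_2,H_3,H_4$: further vertices $v_1,v_2,v_3,v_4$; edges $t_1v_3,t_2v_1,t_3v_2$; and on $\{v_1,\dots,v_4\}$: all six edges for $H_2$; all edges except $v_2v_3$ for $H_3$; exactly $v_1v_2,v_1v_4,v_2v_4,v_3v_4$ for $H_4$. - In all of $H_5,\dots,H_{11}$: $\{x_1,x_2\}$ and $\{t_1,\dots,t_5\}$ are disjoint independent sets of vertices, and all ten edges $x_jt_i$ are present. In addition: - $H_5$ (with parameter $p\ge5$): a complete graph $K_p$ with distinct vertices $y_1,\dots,y_5$, and edges $t_iy_i$, $i=1,\dots,5$. - $H_6,\dots,H_{10}$: further vertices $v_0,\dots,v_5$, with $v_0$ adjacent to each of $v_1,\dots,v_5$, and also: $H_6$: all six edges among $v_2,v_3,v_4,v_5$; the edge $x_2v_1$; edges $t_iv_i$ ($1\le i\le5$). $H_7$: $v_1v_2$, $v_3v_4,v_4v_5,v_3v_5$; edges $t_iv_i$ ($1\le i\le 5$). $H_8$: $v_1v_2,v_1v_3$, $v_3v_4,v_4v_5,v_3v_5$; the edge $x_1v_2$; edges $t_1v_2,t_2v_1,t_3v_3,t_4v_4,t_5v_5$. $H_9$: $v_1v_2,v_1v_3,v_1v_4,v_1v_5$, $v_2v_3,v_4v_5$; edges $t_1v_2,t_2v_3,t_3v_1,t_4v_4,t_5v_5$. $H_{10}$: $v_1v_2,v_2v_3,v_3v_4,v_4v_5,v_5v_1$; edges $t_iv_i$ ($1\le i\le5$). - $H_{11}$: further vertices $v_1,\dots,v_6$; the triangles $v_1v_2v_3$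 and $v_4v_5v_6$; edges $t_1v_1,t_2v_2,t_3v_3,t_3v_4,t_4v_5,t_5v_6$. *)

theory Defs
  imports Complex_Main "Graph_Theory.Graph_Theory"
begin

text \<open>
  As in the imported theory, a finite simple undirected graph is a finite loop-free symmetric digraph
  without parallel arcs (locales \<^locale>\<open>graph\<close> and \<^locale>\<open>pair_graph\<close>): the edge
  \<open>uv\<close> is the pair of arcs \<open>(u, v)\<close>, \<open>(v, u)\<close>.
  For such graphs, the degree is the out-degree, and the components are the strongly connected
  components.
\<close>

definition undirected :: "'a set \<Rightarrow> ('a \<times> 'a) set \<Rightarrow> 'a pair_pre_digraph" where
  "undirected A E = \<lparr> pverts = A, parcs = E \<union> E\<inverse> \<rparr>"

definition clique_edges :: "'a set \<Rightarrow> ('a \<times> 'a) set" where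
  "clique_edges A = A \<times> A - Id"

definition path_graph :: "nat \<Rightarrow> nat pair_pre_digraph" where
  "path_graph b = undirected {1..b} {(i, Suc i) | i. 1 \<le> i \<and> i < b}"

definition disjoint_union ::
  "'a pair_pre_digraph \<Rightarrow> 'b pair_pre_digraph \<Rightarrow> ('a + 'b) pair_pre_digraph" (infixr "\<uplus>" 65) where
  "G \<uplus> H = \<lparr> pverts = pverts G <+> pverts H,
     parcs = map_prod Inl Inl ` parcs G \<union> map_prod Inr Inr ` parcs H \<rparr>"

definition copies :: "nat \<Rightarrow> 'a pair_pre_digraph \<Rightarrow> (nat \<times> 'a) pair_pre_digraph" where
  "copies a G = \<lparr> pverts = {1..a} \<times> pverts G,
     parcs = {((k, u), (k, w)) | k u w. k \<in> {1..a} \<and> (u, w) \<in> parcs G} \<rparr>"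

definition is_free :: "('a, 'b) pre_digraph \<Rightarrow> ('c, 'd) pre_digraph \<Rightarrow> bool" where
  "is_free G R \<longleftrightarrow> \<not> (\<exists>H. induced_subgraph H G \<and> digraph_iso H R)"

definition two_factor :: "('a, 'b) pre_digraph \<Rightarrow> ('a, 'b) pre_digraph \<Rightarrow> bool" where
  "two_factor F G \<longleftrightarrow> graph F \<and> spanning F G \<and> (\<forall>v \<in> verts F. out_degree F v = 2)"

definition num_components :: "('a, 'b) pre_digraph \<Rightarrow> nat" where
  "num_components G = card (pre_digraph.sccs G)"

definition cutset :: "('a, 'b) pre_digraph \<Rightarrow> 'a set \<Rightarrow> bool" where
  "cutset G W \<longleftrightarrow> W \<subseteq> verts G \<and> num_components (G \<restriction> (verts G - W)) \<ge> 2"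

definition tough :: "real \<Rightarrow> ('a, 'b) pre_digraph \<Rightarrow> bool" where
  "tough t G \<longleftrightarrow>
     (\<forall>W. cutset G W \<longrightarrow> t * real (num_components (G \<restriction> (verts G - W))) \<le> real (card W))"

text \<open>Unspecified for complete graphs, for which no greatest \<open>t\<close> exists.\<close>

definition toughness :: "('a, 'b) pre_digraph \<Rightarrow> real" where
  "toughness G = (GREATEST t. tough t G)"

datatype vertex = X nat | T nat | V nat | Y nat

definition H0 :: "vertex pair_pre_digraph" where
  "H0 = undirected (T ` {1..3} \<union> V ` {1..6})
     (clique_edges {V 1, V 2, V 3} \<union> clique_edges {V 4, V 5, V 6} \<union>
      {(T 1, V 1), (T 1, V 4), (T 2, V 2), (T 2, V 5), (T 3, V 3), (T 3, V 6)})"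

text \<open>In \<open>H1\<close> to \<open>H4\<close>, the vertex \<open>X 0\<close> is the vertex \<open>x\<close>.\<close>

definition star_edges :: "(vertex \<times> vertex) set" where
  "star_edges = {(X 0, T 1), (X 0, T 2), (X 0, T 3)}"

definition H1 :: "vertex pair_pre_digraph" where
  "H1 = undirected ({X 0} \<union> T ` {1..3} \<union> V ` {1..3})
     (star_edges \<union> clique_edges {V 1, V 2, V 3} \<union> {(T 1, V 1), (T 2, V 2), (T 3, V 3)})"

definition H2 :: "vertex pair_pre_digraph" where
  "H2 = undirected ({X 0} \<union> T ` {1..3} \<union> V ` {1..4})
     (star_edges \<union> {(T 1, V 3), (T 2, V 1), (T 3, V 2)} \<union>
      clique_edges {V 1, V 2, V 3, V 4})"

definition H3 :: "vertex pair_pre_digraph" where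
  "H3 = undirected ({X 0} \<union> T ` {1..3} \<union> V ` {1..4})
     (star_edges \<union> {(T 1, V 3), (T 2, V 1), (T 3, V 2)} \<union>
      (clique_edges {V 1, V 2, V 3, V 4} - {(V 2, V 3), (V 3, V 2)}))"

definition H4 :: "vertex pair_pre_digraph" where
  "H4 = undirected ({X 0} \<union> T ` {1..3} \<union> V ` {1..4})
     (star_edges \<union> {(T 1, V 3), (T 2, V 1), (T 3, V 2)} \<union>
      {(V 1, V 2), (V 1, V 4), (V 2, V 4), (V 3, V 4)})"

definition xt_edges :: "(vertex \<times> vertex) set" where
  "xt_edges = X ` {1, 2} \<times> T ` {1..5}"

definition H5 :: "nat \<Rightarrow> vertex pair_pre_digraph" where
  "H5 p = undirected (X ` {1, 2} \<union> T ` {1..5} \<union> Y ` {1..p})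
     (xt_edges \<union> clique_edges (Y ` {1..p}) \<union> {(T i, Y i) | i. i \<in> {1..5}})"

definition hub_edges :: "(vertex \<times> vertex) set" where
  "hub_edges = {(V 0, V i) | i. i \<in> {1..5}}"

definition H6 :: "vertex pair_pre_digraph" where
  "H6 = undirected (X ` {1, 2} \<union> T ` {1..5} \<union> V ` {0..5})
     (xt_edges \<union> hub_edges \<union> clique_edges {V 2, V 3, V 4, V 5} \<union> {(X 2, V 1)} \<union>
      {(T i, V i) | i. i \<in> {1..5}})"

definition H7 :: "vertex pair_pre_digraph" where
  "H7 = undirected (X ` {1, 2} \<union> T ` {1..5} \<union> V ` {0..5})
     (xt_edges \<union> hub_edges \<union>
      {(V 1, V 2), (V 3, V 4), (V 4, V 5), (V 3, V 5)} \<union>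
      {(T i, V i) | i. i \<in> {1..5}})"

definition H8 :: "vertex pair_pre_digraph" where
  "H8 = undirected (X ` {1, 2} \<union> T ` {1..5} \<union> V ` {0..5})
     (xt_edges \<union> hub_edges \<union>
      {(V 1, V 2), (V 1, V 3), (V 3, V 4), (V 4, V 5), (V 3, V 5)} \<union> {(X 1, V 2)} \<union>
      {(T 1, V 2), (T 2, V 1), (T 3, V 3), (T 4, V 4), (T 5, V 5)})"

definition H9 :: "vertex pair_pre_digraph" where
  "H9 = undirected (X ` {1, 2} \<union> T ` {1..5} \<union> V ` {0..5})
     (xt_edges \<union> hub_edges \<union>
      {(V 1, V 2), (V 1, V 3), (V 1, V 4), (V 1, V 5), (V 2, V 3), (V 4, V 5)} \<union>
      {(T 1, V 2), (T 2, V 3), (T 3, V 1), (T 4, V 4), (T 5, V 5)})"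

definition H10 :: "vertex pair_pre_digraph" where
  "H10 = undirected (X ` {1, 2} \<union> T ` {1..5} \<union> V ` {0..5})
     (xt_edges \<union> hub_edges \<union>
      {(V 1, V 2), (V 2, V 3), (V 3, V 4), (V 4, V 5), (V 5, V 1)} \<union>
      {(T i, V i) | i. i \<in> {1..5}})"

definition H11 :: "vertex pair_pre_digraph" where
  "H11 = undirected (X ` {1, 2} \<union> T ` {1..5} \<union> V ` {1..6})
     (xt_edges \<union> clique_edges {V 1, V 2, V 3} \<union> clique_edges {V 4, V 5, V 6} \<union>
      {(T 1, V 1), (T 2, V 2), (T 3, V 3), (T 3, V 4), (T 4, V 5), (T 5, V 6)})"

lemma pair_graph_undirected:
  assumes "finite A" "E \<subseteq> A \<times> A" "irrefl E"
  shows "pair_graph (undirected A E)"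
proof -
  have "finite E" using assms finite_subset by fastforce
  then show ?thesis
    using assms
    by unfold_locales
       (auto simp: undirected_def symmetric_def irrefl_def intro: symI)
qed

lemma clique_edges_subset: "A \<subseteq> B \<Longrightarrow> clique_edges A \<subseteq> B \<times> B"
  by (auto simp: clique_edges_def)

lemma not_in_clique_edges: "(v, v) \<notin> clique_edges A"
  by (simp add: clique_edges_def)

lemma pair_graph_H5: "p \<ge> 5 \<Longrightarrow> pair_graph (H5 p)"
  unfolding H5_def xt_edges_def
  by (rule pair_graph_undirected;
      (simp; fail | intro Un_least clique_edges_subset; force |
       force simp: irrefl_def not_in_clique_edges))

lemma pair_graph_H:
      "pair_graph H0"
  and "pair_graph H1"
  and "pair_graph H2"
  and "pair_graph H3"
  and "pair_graph H4"
  and "pair_graph H6"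
  and "pair_graph H7"
  and "pair_graph H8"
  and "pair_graph H9"
  and "pair_graph H10"
  and "pair_graph H11"
  unfolding H0_def H1_def H2_def H3_def H4_def H6_def H7_def H8_def H9_def H10_def
    H11_def star_edges_def xt_edges_def hub_edges_def
  by (rule pair_graph_undirected;
      (simp; fail | intro Un_least Diff_subset[THEN subset_trans] clique_edges_subset; force |
       force simp: irrefl_def not_in_clique_edges))+

end

theory Submission
  imports Defs
begin

text \<open>
  The graphs split into an independent set \<open>T\<close>, a small set \<open>X\<close> of vertices joined to \<open>T\<close> (empty in
  \<open>H0\<close>), and a remainder that is attached to \<open>T\<close> by one or two edges per vertex of
  \<open>T\<close>. This shape rules out a 2-factor and suggests the extremal cutsets; the bounds on all cutsets and
  the forbidden subgraphs are finite checks.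

  \<^emph>\<open>No 2-factor.\<close> Every vertex of \<open>T\<close> needs two edges of a 2-factor, so the demand is \<open>2 |T|\<close>. The
  vertices of \<open>X\<close> can supply at most \<open>2 |X|\<close> of it and the edges between \<open>T\<close> and the remainder supply
  at most their number. In \<open>H0\<close> and \<open>H11\<close> these supplies add up to exactly the demand, in the other
  graphs to less. In the tight case all edges from \<open>T\<close> to the remainder are forced into the 2-factor
  and no vertex of the remainder uses \<open>X\<close>; then three forced edges enter the triangle \<open>v\<^sub>1v\<^sub>2v\<^sub>3\<close>, while
  the number of edges of a 2-factor leaving any vertex set is even. This is the easy direction of
  Tutte's factor theorem, \<open>no_two_factor_if_odd_barrier\<close>.

  \<^emph>\<open>Toughness.\<close> Write \<open>c\<close> for the number of components of \<open>G - W\<close>, where \<open>W\<close> is a cutset. In \<open>H0\<close>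
  to \<open>H4\<close> always \<open>|W| \<ge> c\<close>, and deleting the two neighbours of \<open>t\<^sub>1\<close> gives equality. In the larger
  graphs always \<open>|W| \<ge> c + 1\<close>. As \<open>|W| + c\<close> is at most the number of vertices, \<open>c \<le> 5\<close> for the 12
  vertices of \<open>H5\<close> and \<open>c \<le> 6\<close> for the 13 vertices of \<open>H6\<close> to \<open>H11\<close>; hence
  \<open>|W| / c \<ge> 1 + 1 / c\<close> is at least \<open>6 / 5\<close> and \<open>7 / 6\<close>. An explicit cutset attains these values: \<open>x\<^sub>1, x\<^sub>2\<close>
  and all but one vertex of the \<open>K\<^sub>5\<close> in \<open>H5\<close>; \<open>x\<^sub>1, x\<^sub>2\<close> and the rim \<open>v\<^sub>1, \<dots>, v\<^sub>5\<close> in \<open>H6\<close> to \<open>H10\<close>,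
  which isolates \<open>v\<^sub>0\<close> and every \<open>t\<^sub>i\<close>; and \<open>x\<^sub>1, x\<^sub>2, t\<^sub>3, v\<^sub>1, v\<^sub>2, v\<^sub>5, v\<^sub>6\<close> in \<open>H11\<close>. The inequality for
  all \<open>W\<close> is a finite check, \<open>scattering_scan\<close>: the vertices are kept or deleted one by one, and all
  that must be remembered of the kept part is which later vertices each of its components sees.

  \<^emph>\<open>Forbidden subgraphs.\<close> An induced \<open>P\<^sub>b \<union> aP\<^sub>1\<close> is a path on \<open>b\<close> vertices with \<open>a\<close> independent vertices
  outside its closed neighbourhood. For each path there are few candidates left, and
  \<open>linear_forest_free\<close> searches them.

  Both checks run on the rows of the adjacency matrix right of the diagonal, as lists of Booleans, so
  that rewriting can carry them out once they are proved sound.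
\<close>

section \<open>Counting components\<close>

lemma num_components_eq_card_scc_of:
  assumes "fin_digraph G"
  shows "num_components G = card (pre_digraph.scc_of G ` verts G)"
proof -
  interpret fin_digraph G by fact
  show ?thesis
    by (simp add: num_components_def card_sccs_verts[symmetric] sccs_verts_conv_scc_of)
qed

text \<open>
  Two vertices of one connected set lie in the same component, so each set of the cover accounts for
  at most one component. The sets need not be disjoint, nonempty or maximal.
\<close>

lemma num_components_le_length_cover:
  assumes "fin_digraph G"
    and cover: "verts G \<subseteq> \<Union> (set Bs)"
    and connected: "\<And>B u v. B \<in> set Bs \<Longrightarrow> u \<in> B \<Longrightarrow> v \<in> B \<Longrightarrow> u \<rightarrow>\<^sup>*\<^bsub>G\<^esub> v"
  shows "num_components G \<le> length Bs"
proof -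
  interpret fin_digraph G by fact
  have rep: "scc_of v = scc_of (SOME u. u \<in> B)" if "B \<in> set Bs" "v \<in> B" for B v
  proof -
    have "(SOME u. u \<in> B) \<in> B" using that(2) by (rule someI)
    then show ?thesis
      using connected that by (intro scc_of_eq) (auto simp: scc_of_def)
  qed
  have "scc_of ` verts G \<subseteq> (\<lambda>B. scc_of (SOME u. u \<in> B)) ` set Bs"
  proof
    fix C assume "C \<in> scc_of ` verts G"
    then obtain v where v: "v \<in> verts G" "C = scc_of v" by auto
    then obtain B where "B \<in> set Bs" "v \<in> B" using cover by auto
    then show "C \<in> (\<lambda>B. scc_of (SOME u. u \<in> B)) ` set Bs"
      using rep v(2) by (intro image_eqI[of _ _ B]) simp_all
  qed
  then have "card (scc_of ` verts G) \<le> card (set Bs)"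
    by (meson List.finite_set surj_card_le)
  then show ?thesis
    using card_length[of Bs] by (simp add: num_components_eq_card_scc_of[OF assms(1)])
qed

text \<open>
  A labelling that is constant along arcs is constant on components; this bounds their number from
  below without determining them.
\<close>

lemma card_labels_le_num_components:
  assumes "fin_digraph G"
    and label: "\<And>e. e \<in> arcs G \<Longrightarrow> lab (tail G e) = lab (head G e)"
  shows "card (lab ` verts G) \<le> num_components G"
proof -
  interpret fin_digraph G by fact
  have reach: "lab u = lab v" if "u \<rightarrow>\<^sup>*\<^bsub>G\<^esub> v" for u v
    using that by induct (auto simp: arcs_ends_conv label)
  have "lab (SOME u. u \<in> scc_of v) = lab v" if "v \<in> verts G" for v
  proof -
    have "(SOME u. u \<in> scc_of v) \<in> scc_of v"
      using in_scc_of_self[OF that] by (rule someI)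
    then show ?thesis by (auto simp: scc_of_def intro: reach)
  qed
  then have "lab ` verts G \<subseteq> (\<lambda>C. lab (SOME u. u \<in> C)) ` scc_of ` verts G"
    by force
  then show ?thesis
    by (metis num_components_eq_card_scc_of[OF assms(1)] finite_imageI finite_verts surj_card_le)
qed

lemma fin_digraph_induce_subgraph:
  assumes "fin_digraph G" "A \<subseteq> verts G"
  shows "fin_digraph (G \<restriction> A)"
proof -
  interpret fin_digraph G by fact
  show ?thesis
    using assms(2) by unfold_locales (auto intro: finite_subset)
qed

lemma num_components_induce_le_card:
  assumes "fin_digraph G" "A \<subseteq> verts G"
  shows "num_components (G \<restriction> A) \<le> card A"
proof -
  interpret fin_digraph G by fact
  show ?thesis
    using assms fin_digraph_induce_subgraph[OF assms]
    by (simp add: num_components_eq_card_scc_of card_image_le finite_subset)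
qed

text \<open>
  The parts are connected inside \<open>G \<restriction> A\<close>, but nothing forbids arcs between different parts: an upper
  bound on the number of components asks for no more.
\<close>

definition connected_cover :: "('a, 'b) pre_digraph \<Rightarrow> 'a set \<Rightarrow> 'a set list \<Rightarrow> bool" where
  "connected_cover G A Bs \<longleftrightarrow>
     \<Union> (set Bs) = A \<and> (\<forall>B \<in> set Bs. \<forall>u \<in> B. \<forall>v \<in> B. u \<rightarrow>\<^sup>*\<^bsub>G \<restriction> A\<^esub> v)"

text \<open>
  Through the new vertex, the parts that see it become one connected part; the others stay connected
  because the graph has only grown.
\<close>

lemma connected_cover_insert:
  assumes G: "graph G" and cov: "connected_cover G A Bs"
    and A: "A \<subseteq> verts G" and v: "v \<in> verts G"
  shows "connected_cover G (insert v A)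
    (insert v (\<Union> {B \<in> set Bs. \<exists>b \<in> B. b \<rightarrow>\<^bsub>G\<^esub> v}) # filter (\<lambda>B. \<not> (\<exists>b \<in> B. b \<rightarrow>\<^bsub>G\<^esub> v)) Bs)"
proof -
  interpret G: graph G by fact
  let ?A = "insert v A"
  interpret K: wf_digraph "G \<restriction> ?A" by (rule G.wellformed_induce_subgraph)
  have old: "u \<rightarrow>\<^sup>*\<^bsub>G \<restriction> ?A\<^esub> w" if "B \<in> set Bs" "u \<in> B" "w \<in> B" for B u w
    using that cov unfolding connected_cover_def
    by (meson G.reachable_induce_ss subset_insertI)
  have sub: "B \<subseteq> A" if "B \<in> set Bs" for B
    using that cov by (auto simp: connected_cover_def)
  have arc: "b \<rightarrow>\<^bsub>G \<restriction> ?A\<^esub> v" "v \<rightarrow>\<^bsub>G \<restriction> ?A\<^esub> b" if "b \<in> A" "b \<rightarrow>\<^bsub>G\<^esub> v" for b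
  proof -
    have "v \<rightarrow>\<^bsub>G\<^esub> b" using that(2) G.graph_symmetric by blast
    then show "b \<rightarrow>\<^bsub>G \<restriction> ?A\<^esub> v" "v \<rightarrow>\<^bsub>G \<restriction> ?A\<^esub> b"
      using that by (force simp: arcs_ends_conv)+
  qed
  let ?N = "insert v (\<Union> {B \<in> set Bs. \<exists>b \<in> B. b \<rightarrow>\<^bsub>G\<^esub> v})"
  have toward: "u \<rightarrow>\<^sup>*\<^bsub>G \<restriction> ?A\<^esub> v \<and> v \<rightarrow>\<^sup>*\<^bsub>G \<restriction> ?A\<^esub> u" if u: "u \<in> ?N" for u
  proof (cases "u = v")
    case True
    then show ?thesis by simp
  next
    case False
    with u obtain B b where B: "B \<in> set Bs" "u \<in> B" "b \<in> B" "b \<rightarrow>\<^bsub>G\<^esub> v" by blast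
    then have "b \<in> A" using sub by blast
    with B old arc show ?thesis
      by (meson K.reachable_adj_trans K.adj_reachable_trans)
  qed
  have new: "u \<rightarrow>\<^sup>*\<^bsub>G \<restriction> ?A\<^esub> w" if "u \<in> ?N" "w \<in> ?N" for u w
    using toward[OF that(1)] toward[OF that(2)] K.reachable_trans by blast
  let ?touch = "\<lambda>B. \<exists>b \<in> B. b \<rightarrow>\<^bsub>G\<^esub> v"
  have "\<Union> {B \<in> set Bs. ?touch B} \<union> \<Union> {B \<in> set Bs. \<not> ?touch B} = \<Union> (set Bs)"
    by blast
  then have union: "\<Union> (set (?N # filter (\<lambda>B. \<not> ?touch B) Bs)) = ?A"
    using cov by (simp add: connected_cover_def)
  have "u \<rightarrow>\<^sup>*\<^bsub>G \<restriction> ?A\<^esub> w"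
    if B: "B \<in> set (?N # filter (\<lambda>B. \<not> ?touch B) Bs)" "u \<in> B" "w \<in> B" for B u w
  proof (cases "B = ?N")
    case True
    show ?thesis by (rule new) (use B(2,3) True in \<open>simp_all only:\<close>)
  next
    case False
    then have "B \<in> set Bs" using B(1) by simp
    then show ?thesis using B(2,3) by (rule old)
  qed
  with union show ?thesis unfolding connected_cover_def by blast
qed

text \<open>
  Vertices added to \<open>A\<close> create at most one component each. This bound justifies cutting off the scan
  before all vertices are decided.
\<close>

lemma num_components_insert_singletons:
  assumes G: "graph G" and cov: "connected_cover G A Bs"
    and sub: "A \<union> K \<subseteq> verts G" and K: "finite K"
  shows "num_components (G \<restriction> (A \<union> K)) \<le> length Bs + card K"
proof -
  interpret G: graph G by fact
  obtain ks where ks: "set ks = K" "distinct ks"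
    using finite_distinct_list[OF K] by blast
  have fin: "fin_digraph (G \<restriction> (A \<union> K))"
    using G.fin_digraph_axioms sub by (rule fin_digraph_induce_subgraph)
  interpret K: fin_digraph "G \<restriction> (A \<union> K)" by fact
  have "num_components (G \<restriction> (A \<union> K)) \<le> length (Bs @ map (\<lambda>v. {v}) ks)"
  proof (rule num_components_le_length_cover[OF fin])
    show "verts (G \<restriction> (A \<union> K)) \<subseteq> \<Union> (set (Bs @ map (\<lambda>v. {v}) ks))"
      using cov ks by (auto simp: connected_cover_def)
  next
    fix B u v
    assume B: "B \<in> set (Bs @ map (\<lambda>v. {v}) ks)" "u \<in> B" "v \<in> B"
    show "u \<rightarrow>\<^sup>*\<^bsub>G \<restriction> (A \<union> K)\<^esub> v"
    proof (cases "B \<in> set Bs")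
      case True
      then have "u \<rightarrow>\<^sup>*\<^bsub>G \<restriction> A\<^esub> v" using B cov by (simp add: connected_cover_def)
      then show ?thesis by (meson G.reachable_induce_ss Un_upper1)
    next
      case False
      then have "v = u" "u \<in> K" using B ks(1) by auto
      then show ?thesis by simp
    qed
  qed
  then show ?thesis using ks distinct_card by fastforce
qed

section \<open>Graphs given by a vertex list\<close>

text \<open>
  The bridge between graphs as sets of arcs and the searches, which run through the vertices in the
  order of \<open>vs\<close> and ask a Boolean function for adjacency.
\<close>

locale enumerated_graph =
  fixes G :: "'a pair_pre_digraph" and vs :: "'a list" and adj :: "'a \<Rightarrow> 'a \<Rightarrow> bool"
  assumes pair_graph: "pair_graph G"
    and verts_eq: "pverts G = set vs"
    and distinct_vs: "distinct vs"
    and adj_iff: "adj u v \<longleftrightarrow> (u, v) \<in> parcs G"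
begin

lemma graph: "graph (with_proj G)"
proof -
  interpret pair_graph G by (rule pair_graph)
  show ?thesis by unfold_locales
qed

end

section \<open>Toughness by a scan over all cutsets\<close>

text \<open>
  Only adjacency to later vertices is recorded: the scan over the cutsets and the search for independent
  sets look ahead from a vertex, never back.
\<close>

fun adjacency_rows :: "('a \<Rightarrow> 'a \<Rightarrow> bool) \<Rightarrow> 'a list \<Rightarrow> bool list list" where
  "adjacency_rows adj [] = []"
| "adjacency_rows adj (v # vs) = map (adj v) vs # adjacency_rows adj vs"

lemma length_adjacency_rows [simp]: "length (adjacency_rows adj vs) = length vs"
  by (induction vs) auto

text \<open>
  A block of kept vertices is represented by the Boolean row of its adjacencies to the undecided
  vertices. When the first of these is kept, with row \<open>r\<close>, it absorbs all blocks whose row begins with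
  \<open>True\<close>; the disjunction of the rows is the row of the union.
\<close>

definition merge_blocks :: "bool list \<Rightarrow> bool list list \<Rightarrow> bool list list" where
  "merge_blocks r P =
     fold (\<lambda>p s. map2 (\<or>) (tl p) s) (filter hd P) r # map tl (filter (\<lambda>p. \<not> hd p) P)"

text \<open>
  Each undecided vertex is first deleted, which increases the number \<open>w\<close> of deleted vertices, and then
  kept. The value is \<open>True\<close> if every outcome leaves at most one block or at most \<open>w - d\<close> blocks. A branch
  ends early when even the undecided vertices, each counted as a further component, could not exceed
  the bound. The conditionals make rewriting skip the branches that are not needed.
\<close>

fun scattering_scan :: "nat \<Rightarrow> bool list list \<Rightarrow> bool list list \<Rightarrow> nat \<Rightarrow> bool" where
  "scattering_scan d [] P w = (if length P \<le> 1 then True else length P + d \<le> w)"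
| "scattering_scan d (r # rs) P w =
     (if length P + length (r # rs) + d \<le> w then True
      else if scattering_scan d rs (map tl P) (Suc w)
        then scattering_scan d rs (merge_blocks r P) w else False)"

text \<open>
  The row by which a block \<open>B\<close> is represented in the scan.
\<close>

definition row_of :: "('a \<Rightarrow> 'a \<Rightarrow> bool) \<Rightarrow> 'a list \<Rightarrow> 'a set \<Rightarrow> bool list" where
  "row_of adj vs B = map (\<lambda>u. \<exists>b \<in> B. adj b u) vs"

lemma fold_rows:
  "fold (\<lambda>p s. map2 (\<or>) (tl p) s) (map (row_of adj (v # vs)) Cs) (row_of adj vs D)
     = row_of adj vs (D \<union> \<Union> (set Cs))"
proof (induction Cs arbitrary: D)
  case (Cons C Cs)
  have "map2 (\<or>) (tl (row_of adj (v # vs) C)) (row_of adj vs D) = row_of adj vs (D \<union> C)"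
    by (simp add: row_of_def map2_map_map) blast
  with Cons show ?case by (simp add: Un_assoc)
qed simp

lemma merge_blocks_rows:
  "merge_blocks (map (adj v) vs) (map (row_of adj (v # vs)) Bs) =
   map (row_of adj vs)
     (insert v (\<Union> {B \<in> set Bs. \<exists>b \<in> B. adj b v}) # filter (\<lambda>B. \<not> (\<exists>b \<in> B. adj b v)) Bs)"
proof -
  have hd: "hd \<circ> row_of adj (v # vs) = (\<lambda>B. \<exists>b \<in> B. adj b v)"
    by (simp add: fun_eq_iff row_of_def)
  have tl: "tl \<circ> row_of adj (v # vs) = row_of adj vs"
    by (simp add: fun_eq_iff row_of_def)
  have row: "map (adj v) vs = row_of adj vs {v}"
    by (simp add: row_of_def)
  have "filter hd (map (row_of adj (v # vs)) Bs)
      = map (row_of adj (v # vs)) (filter (\<lambda>B. \<exists>b \<in> B. adj b v) Bs)"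
    by (simp add: filter_map hd)
  moreover have "map tl (filter (\<lambda>p. \<not> hd p) (map (row_of adj (v # vs)) Bs))
      = map (row_of adj vs) (filter (\<lambda>B. \<not> (\<exists>b \<in> B. adj b v)) Bs)"
    by (simp add: filter_map comp_def fun_eq_iff row_of_def)
  ultimately show ?thesis
    unfolding merge_blocks_def row by (simp only: fold_rows) simp
qed

context enumerated_graph
begin

text \<open>
  Here \<open>A\<close> is the set of vertices kept so far, \<open>w\<close> the number deleted so far, and \<open>K\<close> the choice of the
  undecided vertices \<open>us\<close> that are still to be kept. Keeping the row of every block is enough, because
  blocks interact with later vertices only through their rows.
\<close>

lemma scattering_scan_sound:
  assumes "scattering_scan d (adjacency_rows adj us) (map (row_of adj us) Bs) w"
    and "connected_cover (with_proj G) A Bs"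
    and "distinct us" "A \<inter> set us = {}" "A \<union> set us \<subseteq> pverts G" "K \<subseteq> set us"
  shows "num_components (with_proj G \<restriction> (A \<union> K)) \<le> 1
    \<or> num_components (with_proj G \<restriction> (A \<union> K)) + d \<le> w + card (set us - K)"
  using assms
proof (induction us arbitrary: A Bs w K)
  case Nil
  have "num_components (with_proj G \<restriction> (A \<union> K)) \<le> length Bs + card K"
    using Nil by (intro num_components_insert_singletons[OF graph]) auto
  then show ?case using Nil by (auto split: if_splits)
next
  case (Cons v us)
  let ?P = "map (row_of adj (v # us)) Bs"
  consider (prune) "length Bs + length (v # us) + d \<le> w"
    | (branch) "scattering_scan d (adjacency_rows adj us) (map tl ?P) (Suc w)"
      "scattering_scan d (adjacency_rows adj us) (merge_blocks (map (adj v) us) ?P) w"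
    using Cons.prems(1) by (auto split: if_splits)
  then show ?case
  proof cases
    case prune
    have "num_components (with_proj G \<restriction> (A \<union> K)) \<le> length Bs + card K"
      using Cons.prems finite_subset[OF Cons.prems(6)]
      by (intro num_components_insert_singletons[OF graph]) auto
    moreover have "card K \<le> length (v # us)"
      using Cons.prems(6) by (metis List.finite_set card_length card_mono le_trans)
    ultimately show ?thesis using prune by simp
  next
    case branch
    show ?thesis
    proof (cases "v \<in> K")
      case False
      then have K: "K \<subseteq> set us" using Cons.prems(6) by auto
      have tl: "map tl ?P = map (row_of adj us) Bs"
        by (simp add: row_of_def)
      have "scattering_scan d (adjacency_rows adj us) (map (row_of adj us) Bs) (Suc w)"
        using branch(1) unfolding tl .
      from Cons.IH[OF this Cons.prems(2) _ _ _ K] Cons.prems(3-5)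
      have "num_components (with_proj G \<restriction> (A \<union> K)) \<le> 1
        \<or> num_components (with_proj G \<restriction> (A \<union> K)) + d \<le> Suc w + card (set us - K)"
        by auto
      moreover have "card (set (v # us) - K) = Suc (card (set us - K))"
        using False Cons.prems(3) by (simp add: insert_Diff_if)
      ultimately show ?thesis by simp
    next
      case True
      let ?Bs = "insert v (\<Union> {B \<in> set Bs. \<exists>b \<in> B. adj b v}) # filter (\<lambda>B. \<not> (\<exists>b \<in> B. adj b v)) Bs"
      have "connected_cover (with_proj G) (insert v A) ?Bs"
        using connected_cover_insert[OF graph Cons.prems(2), of v] Cons.prems(5)
        by (simp add: adj_iff)
      moreover have "scattering_scan d (adjacency_rows adj us) (map (row_of adj us) ?Bs) w"
        using branch(2) by (simp only: merge_blocks_rows)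
      moreover have "K - {v} \<subseteq> set us" "insert v A \<inter> set us = {}" "distinct us"
        "insert v A \<union> set us \<subseteq> pverts G"
        using Cons.prems(3-6) by auto
      ultimately have "num_components (with_proj G \<restriction> (insert v A \<union> (K - {v}))) \<le> 1
        \<or> num_components (with_proj G \<restriction> (insert v A \<union> (K - {v}))) + d \<le> w + card (set us - (K - {v}))"
        by (intro Cons.IH[of ?Bs])
      moreover have "insert v A \<union> (K - {v}) = A \<union> K" "set us - (K - {v}) = set (v # us) - K"
        using True Cons.prems(3) by auto
      ultimately show ?thesis by metis
    qed
  qed
qed

lemma num_components_le_card_cutset:
  assumes scan: "scattering_scan d (adjacency_rows adj vs) [] 0"
    and W: "cutset (with_proj G) W"
  shows "num_components (with_proj G \<restriction> (pverts G - W)) + d \<le> card W"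
proof -
  have sub: "W \<subseteq> set vs" and two: "2 \<le> num_components (with_proj G \<restriction> (pverts G - W))"
    using W by (auto simp: cutset_def verts_eq)
  have "num_components (with_proj G \<restriction> ({} \<union> (set vs - W))) \<le> 1
    \<or> num_components (with_proj G \<restriction> ({} \<union> (set vs - W))) + d \<le> 0 + card (set vs - (set vs - W))"
    by (rule scattering_scan_sound[where Bs = "[]"])
       (use scan distinct_vs in \<open>auto simp: connected_cover_def verts_eq\<close>)
  moreover have "set vs - (set vs - W) = W" using sub by auto
  ultimately show ?thesis using two by (simp add: verts_eq)
qed

text \<open>
  The scan gives \<open>|W| \<ge> c + d\<close> for all cutsets, so \<open>|W| / c \<ge> 1 + d / c\<close>, which is at least \<open>(k + d) / k\<close>
  as long as \<open>c \<le> k\<close>. For \<open>d > 0\<close>, more than \<open>k\<close> components would need at least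
  \<open>(k + 1) + (k + 1 + d)\<close> vertices. The labelling shows that deleting \<open>W\<close> leaves at least \<open>k\<close>
  components, so the bound is attained.
\<close>

lemma toughness_eqI:
  assumes scan: "scattering_scan d (adjacency_rows adj vs) [] 0"
    and small: "d = 0 \<or> length vs < 2 * k + 2 + d" and k: "2 \<le> k"
    and W: "set W \<subseteq> set vs" "length W \<le> k + d"
    and lab: "\<And>u v. u \<in> set vs - set W \<Longrightarrow> v \<in> set vs - set W \<Longrightarrow> adj u v \<Longrightarrow> lab u = lab v"
    and parts: "k \<le> card (lab ` (set vs - set W))"
  shows "toughness (with_proj G) = real (k + d) / real k"
  unfolding toughness_def
proof (rule Greatest_equality)
  interpret G: graph "with_proj G" by (rule graph)
  let ?c = "\<lambda>W. num_components (with_proj G \<restriction> (pverts G - W))"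
  show "tough (real (k + d) / real k) (with_proj G)"
    unfolding tough_def
  proof (intro allI impI)
    fix U assume U: "cutset (with_proj G) U"
    have gap: "?c U + d \<le> card U" using num_components_le_card_cutset[OF scan U] .
    have sub: "U \<subseteq> set vs" using U by (simp add: cutset_def verts_eq)
    have "?c U \<le> card (set vs - U)"
      using num_components_induce_le_card[OF G.fin_digraph_axioms, of "pverts G - U"]
      by (simp add: verts_eq)
    moreover have "card (set vs - U) + card U = length vs"
      using sub distinct_card[OF distinct_vs]
      by (metis List.finite_set card_Diff_subset card_mono finite_subset le_add_diff_inverse2)
    ultimately have "d = 0 \<or> ?c U \<le> k" using small gap by linarith
    then have "(k + d) * ?c U \<le> k * (?c U + d)"
      by (auto simp: algebra_simps)
    also have "\<dots> \<le> k * card U" using gap by simp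
    finally have "real (k + d) * real (?c U) \<le> real k * real (card U)"
      by (metis of_nat_le_iff of_nat_mult)
    then show "real (k + d) / real k * real (num_components (with_proj G \<restriction> (verts (with_proj G) - U)))
        \<le> real (card U)"
      using k by (simp add: field_simps)
  qed
next
  fix t assume t: "tough t (with_proj G)"
  interpret G: graph "with_proj G" by (rule graph)
  let ?c = "num_components (with_proj G \<restriction> (pverts G - set W))"
  have "fin_digraph (with_proj G \<restriction> (pverts G - set W))"
    by (rule fin_digraph_induce_subgraph[OF G.fin_digraph_axioms]) simp
  then have "card (lab ` verts (with_proj G \<restriction> (pverts G - set W))) \<le> ?c"
    by (rule card_labels_le_num_components) (auto simp: adj_iff verts_eq intro!: lab)
  with parts have c: "k \<le> ?c" by (simp add: verts_eq)
  then have "cutset (with_proj G) (set W)"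
    using W(1) k by (simp add: cutset_def verts_eq)
  with t have le: "t * real ?c \<le> real (card (set W))" by (simp add: tough_def)
  show "t \<le> real (k + d) / real k"
  proof (cases "t \<le> 0")
    case True
    then show ?thesis by (meson divide_nonneg_nonneg of_nat_0_le_iff order_trans)
  next
    case False
    then have "t * real k \<le> t * real ?c" using c by simp
    also note le
    also have "real (card (set W)) \<le> real (k + d)"
      using W(2) card_length[of W] by linarith
    finally show ?thesis using k by (simp add: field_simps)
  qed
qed

end

text \<open>
  The hypotheses of \<open>toughness_eqI\<close> on the extremal cutset, in executable form.
\<close>

definition toughness_witness ::
  "('a \<Rightarrow> 'a \<Rightarrow> bool) \<Rightarrow> 'a list \<Rightarrow> nat \<Rightarrow> nat \<Rightarrow> 'a list \<Rightarrow> ('a \<Rightarrow> 'b) \<Rightarrow> bool" where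
  "toughness_witness adj vs d k W lab \<longleftrightarrow>
     (d = 0 \<or> length vs < 2 * k + 2 + d) \<and> 2 \<le> k \<and>
     set W \<subseteq> set vs \<and> length W \<le> k + d \<and>
     (let R = filter (\<lambda>v. v \<notin> set W) vs in
        list_all (\<lambda>u. list_all (\<lambda>v. adj u v \<longrightarrow> lab u = lab v) R) R \<and>
        k \<le> length (remdups (map lab R)))"

lemma (in enumerated_graph) toughness_eq:
  assumes "scattering_scan d (adjacency_rows adj vs) [] 0"
    and "toughness_witness adj vs d k W lab"
  shows "toughness (with_proj G) = real (k + d) / real k"
proof (rule toughness_eqI[where W = W and lab = lab])
  let ?R = "filter (\<lambda>v. v \<notin> set W) vs"
  show "d = 0 \<or> length vs < 2 * k + 2 + d" "2 \<le> k" "set W \<subseteq> set vs" "length W \<le> k + d"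
    using assms(2) by (simp_all add: toughness_witness_def)
  show "lab u = lab v" if "u \<in> set vs - set W" "v \<in> set vs - set W" "adj u v" for u v
    using assms(2) that by (auto simp: toughness_witness_def list_all_iff)
  have "lab ` (set vs - set W) = set (remdups (map lab ?R))"
    by auto
  then have "card (lab ` (set vs - set W)) = length (remdups (map lab ?R))"
    by (metis distinct_card distinct_remdups)
  then show "k \<le> card (lab ` (set vs - set W))"
    using assms(2) by (simp add: toughness_witness_def Let_def)
qed (rule assms(1))

section \<open>A parity barrier against 2-factors\<close>

text \<open>
  The arcs come in pairs of opposite arcs.
\<close>

lemma even_card_symmetric_irreflexive:
  assumes "finite r" "sym r" "irrefl r"
  shows "even (card r)"
  using assms
proof (induction r rule: finite_psubset_induct)
  case (psubset r)
  show ?case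
  proof (cases "r = {}")
    case False
    then obtain u v where uv: "(u, v) \<in> r" by auto
    then have vu: "(v, u) \<in> r" and ne: "u \<noteq> v"
      using psubset.prems by (auto dest: symD simp: irrefl_def)
    let ?s = "r - {(u, v), (v, u)}"
    have "even (card ?s)"
      using psubset.prems uv by (intro psubset.IH) (auto simp: sym_def irrefl_def)
    moreover have "card r = card ?s + card {(u, v), (v, u)}"
      using psubset.hyps uv vu by (metis card_Diff_subset card_mono empty_subsetI finite.emptyI
          finite.insertI insert_subset le_add_diff_inverse2)
    ultimately show ?thesis using ne by simp
  qed simp
qed

text \<open>
  Counting arcs of a 2-factor from \<open>D\<close>: the demand \<open>2 |D|\<close> is met by at most \<open>2 |S|\<close> arcs to \<open>S\<close> and by arcs of
  \<open>G\<close> to the other vertices. If these just suffice, every arc of \<open>G\<close> from \<open>D\<close> to a vertex outside \<open>S\<close>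
  belongs to the 2-factor, and \<open>S\<close> is used by \<open>D\<close> alone. Then all the arcs of the 2-factor that leave
  \<open>C\<close> go to \<open>D\<close>, and they are all the arcs of \<open>G\<close> from \<open>C\<close> to \<open>D\<close>. Their number has the parity of
  the degree sum \<open>2 |C|\<close>, since the arcs inside \<open>C\<close> are even in number.
\<close>

lemma no_two_factor_if_odd_barrier:
  fixes G :: "'a pair_pre_digraph" and F :: "('a, 'a \<times> 'a) pre_digraph"
  assumes G: "pair_graph G"
    and sub: "S \<subseteq> pverts G" "D \<subseteq> pverts G" "C \<subseteq> pverts G"
    and disj: "S \<inter> D = {}" "C \<inter> S = {}" "C \<inter> D = {}"
    and count: "2 * card S + card (parcs G \<inter> D \<times> (pverts G - S)) \<le> 2 * card D"
    and closed: "parcs G \<inter> C \<times> (pverts G - (C \<union> S \<union> D)) = {}"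
    and odd: "odd (card (parcs G \<inter> C \<times> D))"
  shows "\<not> two_factor F (with_proj G)"
proof
  assume F: "two_factor F (with_proj G)"
  interpret G: pair_graph G by fact
  interpret F: graph F using F by (simp add: two_factor_def)
  define Vs where "Vs = pverts G"
  define M where "M = arcs F"
  have Vs: "verts F = Vs" and ends: "tail F = fst" "head F = snd" and MG: "M \<subseteq> parcs G"
    using F by (auto simp: two_factor_def spanning_def subgraph_def compatible_def Vs_def M_def)
  have finM: "finite M" by (simp add: M_def)
  have M_V: "M \<subseteq> Vs \<times> Vs"
    using F.wellformed by (force simp: M_def Vs ends)
  have M_sym: "sym M"
    using F.sym_arcs by (simp add: symmetric_def arcs_ends_conv M_def ends)
  have M_irrefl: "irrefl M"
    using F.no_loops by (force simp: M_def ends irrefl_def)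
  have degree: "card {e \<in> M. fst e = v} = 2" if "v \<in> Vs" for v
    using F that by (auto simp: two_factor_def out_degree_def out_arcs_def Vs ends M_def)
  let ?e = "\<lambda>A B. card (M \<inter> A \<times> B)"
  have total: "?e A Vs = 2 * card A" if "A \<subseteq> Vs" for A
  proof -
    have finA: "finite A" using that G.pair_finite_verts by (auto simp: Vs_def intro: finite_subset)
    have "M \<inter> A \<times> Vs = (\<Union>a \<in> A. {e \<in> M. fst e = a})" using M_V by auto
    then have "?e A Vs = (\<Sum>a \<in> A. card {e \<in> M. fst e = a})"
      using finA finM by (simp only:) (subst card_UN_disjoint; auto)
    also have "\<dots> = (\<Sum>a \<in> A. 2)" using degree that by (intro sum.cong) auto
    finally show ?thesis by simp
  qed
  have split: "?e A B = ?e A E + ?e A (B - E)" if "E \<subseteq> B" for A B E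
  proof -
    have "M \<inter> A \<times> B = (M \<inter> A \<times> E) \<union> (M \<inter> A \<times> (B - E))" using that by auto
    then show ?thesis using finM by (simp add: card_Un_disjoint disjoint_iff)
  qed
  have flip: "?e A B = ?e B A" for A B
  proof (rule bij_betw_same_card)
    show "bij_betw prod.swap (M \<inter> A \<times> B) (M \<inter> B \<times> A)"
      using M_sym by (intro bij_betwI[where g = prod.swap]) (auto dest: symD)
  qed
  have finE: "finite (parcs G \<inter> D \<times> (Vs - S))" using G.pair_finite_arcs by blast
  have le: "?e D (Vs - S) \<le> card (parcs G \<inter> D \<times> (Vs - S))"
    using MG finE by (intro card_mono) auto
  have "2 * card D = ?e D S + ?e D (Vs - S)"
    using total[of D] split[of S Vs D] sub by (simp add: Vs_def)
  moreover have "2 * card S = ?e D S + ?e S (Vs - D)"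
    using total[of S] split[of D Vs S] sub flip[of S D] by (simp add: Vs_def)
  \<comment> \<open>The supply does not exceed the demand, so both estimates in the count of arcs are sharp.\<close>
  ultimately have none: "?e S (Vs - D) = 0" and all: "?e D (Vs - S) = card (parcs G \<inter> D \<times> (Vs - S))"
    using count le by (simp_all add: Vs_def)
  have MT: "M \<inter> D \<times> (Vs - S) = parcs G \<inter> D \<times> (Vs - S)"
    using MG all by (intro card_subset_eq[OF finE]) auto
  have CT: "M \<inter> C \<times> D = parcs G \<inter> C \<times> D"
  proof -
    have "(c, t) \<in> M" if "(c, t) \<in> parcs G" "c \<in> C" "t \<in> D" for c t
    proof -
      have "(t, c) \<in> parcs G" using that(1) G.arcs_symmetric by blast
      then have "(t, c) \<in> M" using that(2,3) MT disj sub by (auto simp: Vs_def)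
      then show ?thesis using M_sym by (auto dest: symD)
    qed
    then show ?thesis using MG by auto
  qed
  have "M \<inter> S \<times> (Vs - D) = {}" using none finM by simp
  then have CS: "M \<inter> C \<times> S = {}"
    using M_sym sub disj by (auto simp: Vs_def dest: symD)
  have "M \<inter> C \<times> Vs = (M \<inter> C \<times> C) \<union> (M \<inter> C \<times> D)"
    using closed CS MG sub by (auto simp: Vs_def)
  then have "?e C Vs = ?e C C + ?e C D"
    using finM disj by (simp add: card_Un_disjoint disjoint_iff)
  moreover have "even (?e C C)"
    using finM M_sym M_irrefl
    by (intro even_card_symmetric_irreflexive) (auto simp: sym_def irrefl_def)
  ultimately have "even (?e C D)" using total[of C] sub by (simp add: Vs_def) presburger
  then show False using odd CT by simp
qed

definition arc_count :: "('a \<Rightarrow> 'a \<Rightarrow> bool) \<Rightarrow> 'a list \<Rightarrow> 'a list \<Rightarrow> nat" where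
  "arc_count adj xs ys = length (filter (\<lambda>(u, v). adj u v) (List.product xs ys))"

definition odd_barrier :: "('a \<Rightarrow> 'a \<Rightarrow> bool) \<Rightarrow> 'a list \<Rightarrow> 'a list \<Rightarrow> 'a list \<Rightarrow> 'a list \<Rightarrow> bool" where
  "odd_barrier adj vs S D C \<longleftrightarrow>
     distinct (S @ D @ C) \<and> set (S @ D @ C) \<subseteq> set vs \<and>
     2 * length S + arc_count adj D (filter (\<lambda>v. v \<notin> set S) vs) \<le> 2 * length D \<and>
     list_all (\<lambda>c. list_all (\<lambda>v. v \<in> set (S @ D @ C) \<or> \<not> adj c v) vs) C \<and>
     odd (arc_count adj C D)"

context enumerated_graph
begin

lemma card_arcs_eq_arc_count:
  assumes "distinct xs" "distinct ys"
  shows "card (parcs G \<inter> set xs \<times> set ys) = arc_count adj xs ys"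
proof -
  have "parcs G \<inter> set xs \<times> set ys = set (filter (\<lambda>(u, v). adj u v) (List.product xs ys))"
    by (auto simp: adj_iff)
  then show ?thesis
    using assms by (simp only: arc_count_def distinct_card distinct_filter distinct_product)
qed

lemma no_two_factor:
  assumes "odd_barrier adj vs S D C"
  shows "\<not> two_factor F (with_proj G)"
proof (rule no_two_factor_if_odd_barrier[OF pair_graph, of "set S" "set D" "set C"])
  have dist: "distinct S" "distinct D" "distinct C" and sub: "set (S @ D @ C) \<subseteq> set vs"
    and count: "2 * length S + arc_count adj D (filter (\<lambda>v. v \<notin> set S) vs) \<le> 2 * length D"
    and closed: "\<And>c v. c \<in> set C \<Longrightarrow> v \<in> set vs \<Longrightarrow> v \<in> set (S @ D @ C) \<or> \<not> adj c v"
    and odd: "odd (arc_count adj C D)"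
    using assms by (auto simp: odd_barrier_def list_all_iff)
  show "set S \<subseteq> pverts G" "set D \<subseteq> pverts G" "set C \<subseteq> pverts G"
    using sub by (auto simp: verts_eq)
  show "set S \<inter> set D = {}" "set C \<inter> set S = {}" "set C \<inter> set D = {}"
    using assms by (auto simp: odd_barrier_def)
  have "pverts G - set S = set (filter (\<lambda>v. v \<notin> set S) vs)" by (auto simp: verts_eq)
  then show "2 * card (set S) + card (parcs G \<inter> set D \<times> (pverts G - set S)) \<le> 2 * card (set D)"
    using count dist distinct_vs by (simp only: card_arcs_eq_arc_count distinct_filter distinct_card)
  show "parcs G \<inter> set C \<times> (pverts G - (set C \<union> set S \<union> set D)) = {}"
    using closed by (auto simp: verts_eq adj_iff)
  show "odd (card (parcs G \<inter> set C \<times> set D))"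
    using odd dist by (simp only: card_arcs_eq_arc_count not_False_eq_True)
qed

end

section \<open>Induced subgraphs consisting of a path and isolated vertices\<close>

text \<open>
  An isomorphism onto an induced subgraph, seen as a map into \<open>G\<close>. When arcs are pairs, a map on
  vertices determines the map on arcs that belongs to an isomorphism.
\<close>

definition induced_embedding :: "('b \<Rightarrow> 'a) \<Rightarrow> 'b pair_pre_digraph \<Rightarrow> 'a pair_pre_digraph \<Rightarrow> bool" where
  "induced_embedding f R G \<longleftrightarrow>
     inj_on f (pverts R) \<and> f ` pverts R \<subseteq> pverts G \<and>
     (\<forall>u \<in> pverts R. \<forall>v \<in> pverts R. (f u, f v) \<in> parcs G \<longleftrightarrow> (u, v) \<in> parcs R)"

lemma obtain_induced_embedding:
  assumes "\<not> is_free (with_proj G) (with_proj R)"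
  obtains f where "induced_embedding f R G"
proof -
  obtain H where H: "induced_subgraph H (with_proj G)" and "digraph_iso H (with_proj R)"
    using assms by (auto simp: is_free_def)
  then obtain h where iso: "pre_digraph.digraph_isomorphism H h" and R: "with_proj R = app_iso h H"
    by (auto simp: digraph_iso_def)
  interpret H: wf_digraph H using iso by (simp add: pre_digraph.digraph_isomorphism_def)
  have H_verts: "verts H \<subseteq> pverts G" and H_arcs: "arcs H = {e \<in> parcs G. fst e \<in> verts H \<and> snd e \<in> verts H}"
    and H_ends: "tail H = fst" "head H = snd"
    using H by (auto simp: induced_subgraph_def subgraph_def compatible_def)
  have ends: "arcs_ends H = {e \<in> parcs G. fst e \<in> verts H \<and> snd e \<in> verts H}"
    by (auto simp: arcs_ends_conv H_ends H_arcs)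
  have verts: "pverts R = iso_verts h ` verts H"
    using arg_cong[OF R, of verts] by simp
  have R_ends: "parcs R = (\<lambda>(u, v). (iso_verts h u, iso_verts h v)) ` arcs_ends H"
  proof -
    have "parcs R = arcs_ends (app_iso h H)" by (simp add: R[symmetric])
    also have "\<dots> = (\<lambda>(u, v). (iso_verts h u, iso_verts h v)) ` arcs_ends H"
      using iso by (force simp: arcs_ends_conv H.iso_verts_tail H.iso_verts_head)
    finally show ?thesis .
  qed
  have inj: "inj_on (iso_verts h) (verts H)" using iso by (rule H.digraph_isomorphism_inj_on_verts)
  let ?f = "the_inv_into (verts H) (iso_verts h)"
  have f: "?f (iso_verts h u) = u" if "u \<in> verts H" for u
    using inj that by (rule the_inv_into_f_f)
  have "induced_embedding ?f R G"
    unfolding induced_embedding_def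
  proof (intro conjI ballI)
    show "inj_on ?f (pverts R)" unfolding verts by (rule inj_on_the_inv_into[OF inj])
    show "?f ` pverts R \<subseteq> pverts G" using H_verts f verts by auto
  next
    fix x y assume "x \<in> pverts R" "y \<in> pverts R"
    then obtain u v where uv: "u \<in> verts H" "x = iso_verts h u" "v \<in> verts H" "y = iso_verts h v"
      using verts by auto
    have "(x, y) \<in> parcs R \<longleftrightarrow> (u, v) \<in> arcs_ends H"
      using uv by (auto simp: R_ends ends inj_on_eq_iff[OF inj])
    then show "(?f x, ?f y) \<in> parcs G \<longleftrightarrow> (x, y) \<in> parcs R"
      using uv by (simp add: f ends)
  qed
  then show thesis by (rule that)
qed

lemma disjoint_union_simps:
  "pverts (R \<uplus> S) = pverts R <+> pverts S"
  "(Inl u, Inl v) \<in> parcs (R \<uplus> S) \<longleftrightarrow> (u, v) \<in> parcs R"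
  "(Inr x, Inr y) \<in> parcs (R \<uplus> S) \<longleftrightarrow> (x, y) \<in> parcs S"
  "(Inl u, Inr y) \<notin> parcs (R \<uplus> S)"
  by (auto simp: disjoint_union_def)

lemma induced_embedding_disjoint_union:
  assumes f: "induced_embedding f (R \<uplus> S) G"
  shows "induced_embedding (f \<circ> Inl) R G" "induced_embedding (f \<circ> Inr) S G"
    and "x \<in> pverts R \<Longrightarrow> y \<in> pverts S \<Longrightarrow> f (Inl x) \<noteq> f (Inr y) \<and> (f (Inl x), f (Inr y)) \<notin> parcs G"
proof -
  have inj: "inj_on f (pverts R <+> pverts S)"
    and sub: "f ` (pverts R <+> pverts S) \<subseteq> pverts G"
    and arcs: "\<And>u v. u \<in> pverts R <+> pverts S \<Longrightarrow> v \<in> pverts R <+> pverts S \<Longrightarrow>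
      (f u, f v) \<in> parcs G \<longleftrightarrow> (u, v) \<in> parcs (R \<uplus> S)"
    using f by (auto simp: induced_embedding_def disjoint_union_simps)
  have "inj_on (f \<circ> Inl) (pverts R)" "inj_on (f \<circ> Inr) (pverts S)"
    using inj by (auto simp: inj_on_def)
  then show "induced_embedding (f \<circ> Inl) R G" "induced_embedding (f \<circ> Inr) S G"
    using sub by (auto simp: induced_embedding_def arcs InlI InrI disjoint_union_simps)
  show "f (Inl x) \<noteq> f (Inr y) \<and> (f (Inl x), f (Inr y)) \<notin> parcs G"
    if "x \<in> pverts R" "y \<in> pverts S"
    using inj_onD[OF inj, of "Inl x" "Inr y"] that
    by (auto simp: arcs InlI InrI disjoint_union_simps)
qed

lemma verts_path_graph: "pverts (path_graph b) = {1..b}"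
  and arcs_path_graph: "(i, Suc i) \<in> parcs (path_graph b) \<longleftrightarrow> 1 \<le> i \<and> i < b"
  by (auto simp: path_graph_def undirected_def)

lemma induced_embedding_copies_P1:
  assumes "induced_embedding f (copies a (path_graph 1)) G"
  defines "I \<equiv> f ` pverts (copies a (path_graph 1))"
  shows "card I = a" "I \<subseteq> pverts G" "\<forall>u \<in> I. \<forall>v \<in> I. (u, v) \<notin> parcs G"
proof -
  have verts: "pverts (copies a (path_graph 1)) = {1..a} \<times> {1}"
    and arcs: "parcs (copies a (path_graph 1)) = {}"
    by (auto simp: copies_def path_graph_def undirected_def)
  show "card I = a"
    using assms(1) unfolding I_def induced_embedding_def verts by (simp add: card_image)
  show "I \<subseteq> pverts G" "\<forall>u \<in> I. \<forall>v \<in> I. (u, v) \<notin> parcs G"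
    using assms(1) unfolding I_def induced_embedding_def arcs by auto
qed

text \<open>
  No independent set of size \<open>k\<close> lies within the vertices marked by \<open>M\<close>. Branching on the first vertex:
  leave it out, or take it and unmark its neighbours.
\<close>

fun lacks_independent_set :: "nat \<Rightarrow> bool list \<Rightarrow> bool list list \<Rightarrow> bool" where
  "lacks_independent_set 0 M rs = False"
| "lacks_independent_set (Suc k) (m # M) (r # rs) =
     (if lacks_independent_set (Suc k) M rs
      then if m then lacks_independent_set k (map2 (\<lambda>a b. a \<and> \<not> b) M r) rs else True
      else False)"
| "lacks_independent_set (Suc k) M rs = True"

lemma lacks_independent_set_sound:
  assumes "lacks_independent_set k (map Q us) (adjacency_rows adj us)"
    and "distinct us" "I \<subseteq> {u \<in> set us. Q u}" "\<forall>u \<in> I. \<forall>v \<in> I. \<not> adj u v"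
  shows "card I \<noteq> k"
  using assms
proof (induction us arbitrary: k Q I)
  case Nil
  then show ?case by (cases k) auto
next
  case (Cons v us)
  then obtain j where k: "k = Suc j" by (cases k) auto
  have rest: "lacks_independent_set k (map Q us) (adjacency_rows adj us)"
    using Cons.prems(1) k by (simp split: if_splits)
  show ?case
  proof (cases "v \<in> I")
    case False
    then have "I \<subseteq> {u \<in> set us. Q u}" using Cons.prems(3) by auto
    then show ?thesis using Cons.prems(2,4) by (intro Cons.IH[OF rest]) simp_all
  next
    case True
    then have "Q v" using Cons.prems by auto
    then have "lacks_independent_set j (map2 (\<lambda>a b. a \<and> \<not> b) (map Q us) (map (adj v) us)) (adjacency_rows adj us)"
      using Cons.prems(1) k by (simp split: if_splits)
    then have "lacks_independent_set j (map (\<lambda>u. Q u \<and> \<not> adj v u) us) (adjacency_rows adj us)"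
      by (simp add: map2_map_map)
    moreover have "I - {v} \<subseteq> {u \<in> set us. Q u \<and> \<not> adj v u}"
      using Cons.prems(3,4) True by auto
    ultimately have "card (I - {v}) \<noteq> j"
      using Cons.prems(2,4) by (intro Cons.IH) auto
    moreover have "finite I" using Cons.prems(3) finite_subset by fastforce
    ultimately show ?thesis using True k by (simp add: card_Diff_singleton)
  qed
qed

text \<open>
  The list \<open>p\<close> is a path in reverse, so that its head is the end to be extended by \<open>b\<close> more vertices. It
  need not be an induced path, so more is excluded than an induced \<open>P\<^sub>b \<union> aP\<^sub>1\<close>. The rows \<open>rs\<close> are a
  parameter in order to be computed only once.
\<close>

fun linear_forest_free ::
  "('a \<Rightarrow> 'a \<Rightarrow> bool) \<Rightarrow> 'a list \<Rightarrow> bool list list \<Rightarrow> nat \<Rightarrow> 'a list \<Rightarrow> nat \<Rightarrow> bool" where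
  "linear_forest_free adj vs rs a p 0 =
     lacks_independent_set a (map (\<lambda>v. \<forall>u \<in> set p. u \<noteq> v \<and> \<not> adj u v) vs) rs"
| "linear_forest_free adj vs rs a p (Suc b) =
     list_all (\<lambda>v. if v \<notin> set p \<and> (p = [] \<or> adj (hd p) v)
       then linear_forest_free adj vs rs a (v # p) b else True) vs"

lemma linear_forest_free_sound:
  assumes "linear_forest_free adj vs (adjacency_rows adj vs) a p (length q)" and "distinct vs"
    and "successively adj (rev p @ q)" "distinct (p @ q)" "set q \<subseteq> set vs"
    and "I \<subseteq> set vs" "\<forall>u \<in> I. \<forall>v \<in> I. \<not> adj u v"
    and "\<forall>u \<in> set (p @ q). \<forall>v \<in> I. u \<noteq> v \<and> \<not> adj u v"
  shows "card I \<noteq> a"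
  using assms
proof (induction q arbitrary: p)
  case Nil
  then show ?case by (intro lacks_independent_set_sound[where adj = adj and us = vs]) auto
next
  case (Cons v q)
  have "p = [] \<or> adj (hd p) v"
    using Cons.prems(3) by (auto simp: successively_append_iff last_rev)
  then have "linear_forest_free adj vs (adjacency_rows adj vs) a (v # p) (length q)"
    using Cons.prems(1,4,5) by (auto simp: list_all_iff)
  then show ?case
    by (rule Cons.IH) (use Cons.prems in auto)
qed

context enumerated_graph
begin

lemma is_free_copies_P1:
  assumes "linear_forest_free adj vs (adjacency_rows adj vs) a [] 0"
  shows "is_free (with_proj G) (with_proj (copies a (path_graph 1)))"
proof (rule ccontr)
  assume "\<not> ?thesis"
  then obtain f where "induced_embedding f (copies a (path_graph 1)) G"
    by (rule obtain_induced_embedding)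
  note I = induced_embedding_copies_P1[OF this]
  show False
    using linear_forest_free_sound[of adj vs a "[]" "[]" "f ` pverts (copies a (path_graph 1))"] assms I
    by (simp add: adj_iff verts_eq distinct_vs)
qed

lemma is_free_path_copies_P1:
  assumes "linear_forest_free adj vs (adjacency_rows adj vs) a [] b"
  shows "is_free (with_proj G) (with_proj (path_graph b \<uplus> copies a (path_graph 1)))"
proof (rule ccontr)
  assume "\<not> ?thesis"
  then obtain f where f: "induced_embedding f (path_graph b \<uplus> copies a (path_graph 1)) G"
    by (rule obtain_induced_embedding)
  have path: "induced_embedding (f \<circ> Inl) (path_graph b) G"
    using f by (rule induced_embedding_disjoint_union)
  define I where "I = (f \<circ> Inr) ` pverts (copies a (path_graph 1))"
  note I = induced_embedding_copies_P1[OF induced_embedding_disjoint_union(2)[OF f], folded I_def]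
  define q where "q = map (f \<circ> Inl) [1..<Suc b]"
  have q_set: "set q = (f \<circ> Inl) ` {1..b}"
    by (auto simp: q_def)
  have "successively adj q"
    unfolding successively_conv_nth
    using path by (auto simp: q_def adj_iff induced_embedding_def verts_path_graph
        arcs_path_graph simp del: upt_Suc)
  moreover have "distinct q"
    using path by (simp add: q_def distinct_map induced_embedding_def verts_path_graph
        atLeastLessThanSuc_atLeastAtMost del: upt_Suc)
  moreover have "set q \<subseteq> set vs"
    using path by (simp add: q_set induced_embedding_def verts_path_graph verts_eq)
  moreover have "\<forall>u \<in> set q. \<forall>v \<in> I. u \<noteq> v \<and> \<not> adj u v"
    using induced_embedding_disjoint_union(3)[OF f]
    by (auto simp: q_set I_def adj_iff verts_path_graph)
  moreover have "length q = b" by (simp add: q_def)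
  ultimately show False
    using linear_forest_free_sound[of adj vs a "[]" q I] assms I
    by (simp add: adj_iff verts_eq distinct_vs)
qed

end

section \<open>The graphs and their certificates\<close>

text \<open>
  For each of the graphs, all premises but the first are closed executable terms.
\<close>

lemma (in enumerated_graph) certified_properties:
  assumes "real (k + d) / real k = t"
    and "linear_forest_free adj vs (adjacency_rows adj vs) a [] 2"
    and "odd_barrier adj vs S D C"
    and "scattering_scan d (adjacency_rows adj vs) [] 0"
    and "toughness_witness adj vs d k W lab"
  shows "is_free (with_proj G) (with_proj (path_graph 2 \<uplus> copies a (path_graph 1))) \<and>
    (\<nexists>F. two_factor F (with_proj G)) \<and> toughness (with_proj G) = t"
  using assms(1) is_free_path_copies_P1[OF assms(2)] no_two_factor[OF assms(3)]
    toughness_eq[OF assms(4,5)] by simp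

definition adjacent :: "('a \<times> 'a) list \<Rightarrow> 'a \<Rightarrow> 'a \<Rightarrow> bool" where
  "adjacent es u v \<longleftrightarrow> (u, v) \<in> set es \<or> (v, u) \<in> set es"

lemma enumerated_graphI:
  assumes G: "G = undirected A E" "set vs = A" "set es = E"
    and simple: "distinct vs" "list_all (\<lambda>(u, v). u \<in> set vs \<and> v \<in> set vs \<and> u \<noteq> v) es"
  shows "enumerated_graph G vs (adjacent es)"
proof -
  have "pair_graph (undirected (set vs) (set es))"
    using simple(2) by (intro pair_graph_undirected) (auto simp: list_all_iff irrefl_def)
  then show ?thesis
    using G simple(1) by (simp add: enumerated_graph_def adjacent_def undirected_def)
qed

definition first_nats :: "nat \<Rightarrow> nat list" where
  "first_nats n = [1..<Suc n]"

text \<open>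
  Both orientations of every edge are listed, to match \<open>clique_edges\<close>.
\<close>

definition clique_list :: "'a list \<Rightarrow> ('a \<times> 'a) list" where
  "clique_list xs = filter (\<lambda>(u, v). u \<noteq> v) (List.product xs xs)"

lemma set_first_nats [simp]: "set (first_nats n) = {1..n}"
  by (auto simp: first_nats_def)

lemma set_clique_list [simp]: "set (clique_list xs) = clique_edges (set xs)"
  by (auto simp: clique_list_def clique_edges_def)

definition xt_list :: "(vertex \<times> vertex) list" where
  "xt_list = List.product (map X [1, 2]) (map T (first_nats 5))"

definition hub_list :: "(vertex \<times> vertex) list" where
  "hub_list = map (\<lambda>i. (V 0, V i)) (first_nats 5)"

lemma set_xt_list: "set xt_list = xt_edges"
  by (auto simp: xt_list_def xt_edges_def)

lemma set_hub_list: "set hub_list = hub_edges"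
  by (auto simp: hub_list_def hub_edges_def)

definition star_list :: "(vertex \<times> vertex) list" where
  "star_list = [(X 0, T 1), (X 0, T 2), (X 0, T 3)]"

lemma set_star_list: "set star_list = star_edges"
  by (simp add: star_list_def star_edges_def)

definition xtv_vertices :: "vertex list" where
  "xtv_vertices = map X [1, 2] @ map V (0 # first_nats 5) @ map T (first_nats 5)"

lemma set_xtv_vertices: "set xtv_vertices = X ` {1, 2} \<union> T ` {1..5} \<union> V ` {0..5}"
  by (auto simp: xtv_vertices_def)

definition H0_vertices :: "vertex list" where
  "H0_vertices = map V (first_nats 6) @ map T (first_nats 3)"

definition H0_arcs :: "(vertex \<times> vertex) list" where
  "H0_arcs = clique_list [V 1, V 2, V 3] @
     clique_list [V 4, V 5, V 6] @
     [(T 1, V 1), (T 1, V 4), (T 2, V 2), (T 2, V 5), (T 3, V 3), (T 3, V 6)]"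

lemma enumerated_H0: "enumerated_graph H0 H0_vertices (adjacent H0_arcs)"
  by (rule enumerated_graphI[OF H0_def _])
     (force simp: H0_vertices_def,
      force simp: H0_arcs_def set_star_list set_xt_list set_hub_list,
      code_simp+)

text \<open>
  Each of the triangles is joined to \<open>T\<close> by three edges; either of them serves as the odd set \<open>C\<close>.
  Deleting \<open>v\<^sub>1\<close> and \<open>v\<^sub>4\<close> isolates \<open>t\<^sub>1\<close>; the label tells this vertex from the rest.
\<close>

lemma H0_properties:
  "is_free H0 (path_graph 2 \<uplus> copies 3 (path_graph 1)) \<and>
   (\<nexists>F. two_factor F H0) \<and> toughness H0 = 1"
  by (rule enumerated_graph.certified_properties[OF enumerated_H0,
        where S = "[]" and D = "map T (first_nats 3)" and C = "map V (first_nats 3)"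
          and d = 0 and k = 2 and W = "[V 1, V 4]"
          and lab = "\<lambda>v. v = T 1"])
     (simp, code_simp+)

definition H1_vertices :: "vertex list" where
  "H1_vertices = X 0 # map V (first_nats 3) @ map T (first_nats 3)"

definition H1_arcs :: "(vertex \<times> vertex) list" where
  "H1_arcs = star_list @
     clique_list [V 1, V 2, V 3] @
     [(T 1, V 1), (T 2, V 2), (T 3, V 3)]"

lemma enumerated_H1: "enumerated_graph H1 H1_vertices (adjacent H1_arcs)"
  by (rule enumerated_graphI[OF H1_def _])
     (force simp: H1_vertices_def,
      force simp: H1_arcs_def set_star_list set_xt_list set_hub_list,
      code_simp+)

text \<open>
  The vertices of \<open>T\<close> demand six arcs; \<open>x\<close> supplies two and the remainder three. The two neighbours of
  \<open>t\<^sub>1\<close> form the cutset. The same choices work for \<open>H2\<close>, \<open>H3\<close> and \<open>H4\<close>.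
\<close>

lemma H1_properties:
  "is_free H1 (path_graph 2 \<uplus> copies 3 (path_graph 1)) \<and>
   (\<nexists>F. two_factor F H1) \<and> toughness H1 = 1"
  by (rule enumerated_graph.certified_properties[OF enumerated_H1,
        where S = "[X 0]" and D = "map T (first_nats 3)" and C = "map V (first_nats 3)"
          and d = 0 and k = 2 and W = "[X 0, V 1]"
          and lab = "\<lambda>v. v = T 1"])
     (simp, code_simp+)

definition H2_vertices :: "vertex list" where
  "H2_vertices = X 0 # map V (first_nats 4) @ map T (first_nats 3)"

definition H2_arcs :: "(vertex \<times> vertex) list" where
  "H2_arcs = star_list @
     [(T 1, V 3), (T 2, V 1), (T 3, V 2)] @
     clique_list [V 1, V 2, V 3, V 4]"

lemma enumerated_H2: "enumerated_graph H2 H2_vertices (adjacent H2_arcs)"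
  by (rule enumerated_graphI[OF H2_def _])
     (force simp: H2_vertices_def,
      force simp: H2_arcs_def set_star_list set_xt_list set_hub_list,
      code_simp+)

lemma H2_properties:
  "is_free H2 (path_graph 2 \<uplus> copies 3 (path_graph 1)) \<and>
   (\<nexists>F. two_factor F H2) \<and> toughness H2 = 1"
  by (rule enumerated_graph.certified_properties[OF enumerated_H2,
        where S = "[X 0]" and D = "map T (first_nats 3)" and C = "map V (first_nats 4)"
          and d = 0 and k = 2 and W = "[X 0, V 3]"
          and lab = "\<lambda>v. v = T 1"])
     (simp, code_simp+)

definition H3_vertices :: "vertex list" where
  "H3_vertices = X 0 # map V (first_nats 4) @ map T (first_nats 3)"

definition H3_arcs :: "(vertex \<times> vertex) list" where
  "H3_arcs = star_list @
     [(T 1, V 3), (T 2, V 1), (T 3, V 2)] @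
     filter (\<lambda>e. e \<notin> {(V 2, V 3), (V 3, V 2)}) (clique_list [V 1, V 2, V 3, V 4])"

lemma enumerated_H3: "enumerated_graph H3 H3_vertices (adjacent H3_arcs)"
  by (rule enumerated_graphI[OF H3_def _])
     (force simp: H3_vertices_def,
      force simp: H3_arcs_def set_star_list set_xt_list set_hub_list,
      code_simp+)

lemma H3_properties:
  "is_free H3 (path_graph 2 \<uplus> copies 3 (path_graph 1)) \<and>
   (\<nexists>F. two_factor F H3) \<and> toughness H3 = 1"
  by (rule enumerated_graph.certified_properties[OF enumerated_H3,
        where S = "[X 0]" and D = "map T (first_nats 3)" and C = "map V (first_nats 4)"
          and d = 0 and k = 2 and W = "[X 0, V 3]"
          and lab = "\<lambda>v. v = T 1"])
     (simp, code_simp+)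

definition H4_vertices :: "vertex list" where
  "H4_vertices = X 0 # map V (first_nats 4) @ map T (first_nats 3)"

definition H4_arcs :: "(vertex \<times> vertex) list" where
  "H4_arcs = star_list @
     [(T 1, V 3), (T 2, V 1), (T 3, V 2)] @
     [(V 1, V 2), (V 1, V 4), (V 2, V 4), (V 3, V 4)]"

lemma enumerated_H4: "enumerated_graph H4 H4_vertices (adjacent H4_arcs)"
  by (rule enumerated_graphI[OF H4_def _])
     (force simp: H4_vertices_def,
      force simp: H4_arcs_def set_star_list set_xt_list set_hub_list,
      code_simp+)

lemma H4_properties:
  "is_free H4 (path_graph 2 \<uplus> copies 3 (path_graph 1)) \<and>
   (\<nexists>F. two_factor F H4) \<and> toughness H4 = 1"
  by (rule enumerated_graph.certified_properties[OF enumerated_H4,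
        where S = "[X 0]" and D = "map T (first_nats 3)" and C = "map V (first_nats 4)"
          and d = 0 and k = 2 and W = "[X 0, V 3]"
          and lab = "\<lambda>v. v = T 1"])
     (simp, code_simp+)

definition H5_vertices :: "vertex list" where
  "H5_vertices = map X [1, 2] @ map Y (first_nats 5) @ map T (first_nats 5)"

definition H5_arcs :: "(vertex \<times> vertex) list" where
  "H5_arcs = xt_list @
     clique_list (map Y (first_nats 5)) @
     map (\<lambda>i. (T i, Y i)) (first_nats 5)"

lemma enumerated_H5: "enumerated_graph (H5 5) H5_vertices (adjacent H5_arcs)"
  by (rule enumerated_graphI[OF H5_def _])
     (force simp: H5_vertices_def,
      force simp: H5_arcs_def set_star_list set_xt_list set_hub_list,
      code_simp+)

text \<open>
  The cutset leaves \<open>t\<^sub>1, \<dots>, t\<^sub>4\<close> isolated and the edge \<open>t\<^sub>5y\<^sub>5\<close>, whose two ends receive the same label.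
\<close>

lemma H5_properties:
  "is_free (H5 5) (path_graph 2 \<uplus> copies 5 (path_graph 1)) \<and>
   (\<nexists>F. two_factor F (H5 5)) \<and> toughness (H5 5) = 6 / 5"
  by (rule enumerated_graph.certified_properties[OF enumerated_H5,
        where S = "map X [1, 2]" and D = "map T (first_nats 5)" and C = "map Y (first_nats 5)"
          and d = 1 and k = 5 and W = "map X [1, 2] @ map Y (first_nats 4)"
          and lab = "\<lambda>v. if v = Y 5 then T 5 else v"])
     (simp, code_simp+)

definition H6_arcs :: "(vertex \<times> vertex) list" where
  "H6_arcs = xt_list @
     hub_list @
     clique_list [V 2, V 3, V 4, V 5] @
     [(X 2, V 1)] @
     map (\<lambda>i. (T i, V i)) (first_nats 5)"

lemma enumerated_H6: "enumerated_graph H6 xtv_vertices (adjacent H6_arcs)"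
  by (rule enumerated_graphI[OF H6_def set_xtv_vertices])
     (force simp: H6_arcs_def set_star_list set_xt_list set_hub_list,
      code_simp+)

text \<open>
  The vertices of \<open>T\<close> demand ten arcs; \<open>x\<^sub>1\<close> and \<open>x\<^sub>2\<close> supply four and the remainder five. The cutset
  leaves only isolated vertices, so they may serve as their own labels. The same choices work for
  \<open>H7\<close> to \<open>H10\<close>.
\<close>

lemma H6_properties:
  "is_free H6 (path_graph 2 \<uplus> copies 5 (path_graph 1)) \<and>
   (\<nexists>F. two_factor F H6) \<and> toughness H6 = 7 / 6"
  by (rule enumerated_graph.certified_properties[OF enumerated_H6,
        where S = "map X [1, 2]" and D = "map T (first_nats 5)" and C = "map V (0 # first_nats 5)"
          and d = 1 and k = 6 and W = "map X [1, 2] @ map V (first_nats 5)"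
          and lab = "\<lambda>v. v"])
     (simp, code_simp+)

definition H7_arcs :: "(vertex \<times> vertex) list" where
  "H7_arcs = xt_list @
     hub_list @
     [(V 1, V 2), (V 3, V 4), (V 4, V 5), (V 3, V 5)] @
     map (\<lambda>i. (T i, V i)) (first_nats 5)"

lemma enumerated_H7: "enumerated_graph H7 xtv_vertices (adjacent H7_arcs)"
  by (rule enumerated_graphI[OF H7_def set_xtv_vertices])
     (force simp: H7_arcs_def set_star_list set_xt_list set_hub_list,
      code_simp+)

lemma H7_properties:
  "is_free H7 (path_graph 2 \<uplus> copies 5 (path_graph 1)) \<and>
   (\<nexists>F. two_factor F H7) \<and> toughness H7 = 7 / 6"
  by (rule enumerated_graph.certified_properties[OF enumerated_H7,
        where S = "map X [1, 2]" and D = "map T (first_nats 5)" and C = "map V (0 # first_nats 5)"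
          and d = 1 and k = 6 and W = "map X [1, 2] @ map V (first_nats 5)"
          and lab = "\<lambda>v. v"])
     (simp, code_simp+)

definition H8_arcs :: "(vertex \<times> vertex) list" where
  "H8_arcs = xt_list @
     hub_list @
     [(V 1, V 2), (V 1, V 3), (V 3, V 4), (V 4, V 5), (V 3, V 5)] @
     [(X 1, V 2)] @
     [(T 1, V 2), (T 2, V 1), (T 3, V 3), (T 4, V 4), (T 5, V 5)]"

lemma enumerated_H8: "enumerated_graph H8 xtv_vertices (adjacent H8_arcs)"
  by (rule enumerated_graphI[OF H8_def set_xtv_vertices])
     (force simp: H8_arcs_def set_star_list set_xt_list set_hub_list,
      code_simp+)

lemma H8_properties:
  "is_free H8 (path_graph 2 \<uplus> copies 5 (path_graph 1)) \<and>
   (\<nexists>F. two_factor F H8) \<and> toughness H8 = 7 / 6"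
  by (rule enumerated_graph.certified_properties[OF enumerated_H8,
        where S = "map X [1, 2]" and D = "map T (first_nats 5)" and C = "map V (0 # first_nats 5)"
          and d = 1 and k = 6 and W = "map X [1, 2] @ map V (first_nats 5)"
          and lab = "\<lambda>v. v"])
     (simp, code_simp+)

definition H9_arcs :: "(vertex \<times> vertex) list" where
  "H9_arcs = xt_list @
     hub_list @
     [(V 1, V 2), (V 1, V 3), (V 1, V 4), (V 1, V 5), (V 2, V 3), (V 4, V 5)] @
     [(T 1, V 2), (T 2, V 3), (T 3, V 1), (T 4, V 4), (T 5, V 5)]"

lemma enumerated_H9: "enumerated_graph H9 xtv_vertices (adjacent H9_arcs)"
  by (rule enumerated_graphI[OF H9_def set_xtv_vertices])
     (force simp: H9_arcs_def set_star_list set_xt_list set_hub_list,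
      code_simp+)

lemma H9_properties:
  "is_free H9 (path_graph 2 \<uplus> copies 5 (path_graph 1)) \<and>
   (\<nexists>F. two_factor F H9) \<and> toughness H9 = 7 / 6"
  by (rule enumerated_graph.certified_properties[OF enumerated_H9,
        where S = "map X [1, 2]" and D = "map T (first_nats 5)" and C = "map V (0 # first_nats 5)"
          and d = 1 and k = 6 and W = "map X [1, 2] @ map V (first_nats 5)"
          and lab = "\<lambda>v. v"])
     (simp, code_simp+)

definition H10_arcs :: "(vertex \<times> vertex) list" where
  "H10_arcs = xt_list @
     hub_list @
     [(V 1, V 2), (V 2, V 3), (V 3, V 4), (V 4, V 5), (V 5, V 1)] @
     map (\<lambda>i. (T i, V i)) (first_nats 5)"

lemma enumerated_H10: "enumerated_graph H10 xtv_vertices (adjacent H10_arcs)"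
  by (rule enumerated_graphI[OF H10_def set_xtv_vertices])
     (force simp: H10_arcs_def set_star_list set_xt_list set_hub_list,
      code_simp+)

lemma H10_properties:
  "is_free H10 (path_graph 2 \<uplus> copies 5 (path_graph 1)) \<and>
   (\<nexists>F. two_factor F H10) \<and> toughness H10 = 7 / 6"
  by (rule enumerated_graph.certified_properties[OF enumerated_H10,
        where S = "map X [1, 2]" and D = "map T (first_nats 5)" and C = "map V (0 # first_nats 5)"
          and d = 1 and k = 6 and W = "map X [1, 2] @ map V (first_nats 5)"
          and lab = "\<lambda>v. v"])
     (simp, code_simp+)

definition H11_vertices :: "vertex list" where
  "H11_vertices = map X [1, 2] @ map V (first_nats 6) @ map T (first_nats 5)"

definition H11_arcs :: "(vertex \<times> vertex) list" where
  "H11_arcs = xt_list @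
     clique_list [V 1, V 2, V 3] @
     clique_list [V 4, V 5, V 6] @
     [(T 1, V 1), (T 2, V 2), (T 3, V 3), (T 3, V 4), (T 4, V 5), (T 5, V 6)]"

lemma enumerated_H11: "enumerated_graph H11 H11_vertices (adjacent H11_arcs)"
  by (rule enumerated_graphI[OF H11_def _])
     (force simp: H11_vertices_def,
      force simp: H11_arcs_def set_star_list set_xt_list set_hub_list,
      code_simp+)

text \<open>
  The neighbour of \<open>v\<^sub>3\<close> and of \<open>v\<^sub>4\<close> outside their triangles is \<open>t\<^sub>3\<close>. Deleting it together with the other
  vertices of the triangles isolates both of them, and \<open>t\<^sub>1, t\<^sub>2, t\<^sub>4, t\<^sub>5\<close> as well once \<open>x\<^sub>1\<close> and \<open>x\<^sub>2\<close> are gone.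
\<close>

lemma H11_properties:
  "is_free H11 (path_graph 2 \<uplus> copies 5 (path_graph 1)) \<and>
   (\<nexists>F. two_factor F H11) \<and> toughness H11 = 7 / 6"
  by (rule enumerated_graph.certified_properties[OF enumerated_H11,
        where S = "map X [1, 2]" and D = "map T (first_nats 5)" and C = "map V (first_nats 3)"
          and d = 1 and k = 6 and W = "map X [1, 2] @ [T 3, V 1, V 2, V 5, V 6]"
          and lab = "\<lambda>v. v"])
     (simp, code_simp+)

lemma H1_P3_2P1_free: "is_free H1 (path_graph 3 \<uplus> copies 2 (path_graph 1))"
  by (rule enumerated_graph.is_free_path_copies_P1[OF enumerated_H1]) code_simp

lemma H5_P3_4P1_free: "is_free (H5 5) (path_graph 3 \<uplus> copies 4 (path_graph 1))"
  by (rule enumerated_graph.is_free_path_copies_P1[OF enumerated_H5]) code_simp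

lemma H5_6P1_free: "is_free (H5 5) (copies 6 (path_graph 1))"
  by (rule enumerated_graph.is_free_copies_P1[OF enumerated_H5]) code_simp

theorem theorem5:
  shows "(\<forall>G \<in> {H0, H1, H2, H3, H4}.
            is_free G (path_graph 2 \<uplus> copies 3 (path_graph 1)) \<and>
            (\<nexists>F. two_factor F G) \<and>
            toughness G = 1) \<and>
         is_free H1 (path_graph 3 \<uplus> copies 2 (path_graph 1)) \<and>
         (\<forall>G \<in> {H5 5, H6, H7, H8, H9, H10, H11}.
            is_free G (path_graph 2 \<uplus> copies 5 (path_graph 1)) \<and>
            (\<nexists>F. two_factor F G)) \<and>
         is_free (H5 5) (path_graph 3 \<uplus> copies 4 (path_graph 1)) \<and>
         is_free (H5 5) (copies 6 (path_graph 1)) \<and>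
         toughness (H5 5) = 6 / 5 \<and>
         (\<forall>G \<in> {H6, H7, H8, H9, H10, H11}. toughness G = 7 / 6)"
  using H0_properties H1_properties H2_properties H3_properties H4_properties H5_properties
    H6_properties H7_properties H8_properties H9_properties H10_properties H11_properties
    H1_P3_2P1_free H5_P3_4P1_free H5_6P1_free
  by (simp only: ball_simps simp_thms)

end
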